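(* Let $\alpha>-1/2$, $1<p<\infty$, $M\ge 0$ and $N\ge 0$. The set of polynomials is dense in the space $W_p^{\alpha}$; that is, given $f\in W_p^{\alpha}$, for every $\varepsilon>0$ there exists a polynomial $q_n$ (of some degree $n$) such that $$\|f-q_n\|_{W_p^{\alpha}}<\varepsilon .$$
   Context: Fix $\alpha>-1/2$ and constants $M\ge 0$, $N\ge 0$. Let $\mu_\alpha$ be the probability measure on $[-1,1]$ given by $$d\mu_{\alpha}(x)=\frac{\Gamma(2\alpha+2)}{2^{2\alpha+1}\Gamma^2(\alpha+1)}(1-x^2)^{\alpha}\,dx .$$ $\|f\|_{L^p(d\mu_\alpha)}=\big(\int_{-1}^1|f|^p\,d\mu_\alpha\big)^{1/p}$. Put $\mu_{\alpha,M}=\mu_\alpha+M(\delta_1+\delta_{-1})$. For $1<p<\infty$, $W_p^\alpha$ is the set of equivalence classes, with respect to the (semi)norm of $L^p(\mu_{\alpha,M})$, of (real-valued) measurable functions on $[-1,1]$ such that there is an element $f$ of the class for which the (one-sided) derivatives $f'(1)$ and $f'(-1)$ are defined, and $$\|f\|_{W_p^{\alpha}}^p:=\|f\|_{L^p(d\mu_{\alpha})}^p+M\big(|f(1)|^p+|f(-1)|^p\big)+N\big(|f'(1)|^p+|f'(-1)|^p\big)<\infty .$$ The derivatives at $\pm1$ are those of such a representative. *)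

theory Defs
  imports "HOL-Analysis.Analysis" "HOL-Computational_Algebra.Polynomial"
begin

definition jacobi_measure :: "real \<Rightarrow> real measure" where
  "jacobi_measure \<alpha> = density (lebesgue_on {-1..1})
     (\<lambda>x. ennreal (Gamma (2 * \<alpha> + 2) / (2 powr (2 * \<alpha> + 1) * (Gamma (\<alpha> + 1))\<^sup>2)
                     * (1 - x\<^sup>2) powr \<alpha>))"

text \<open>The library has no sum of measures, so \<open>\<mu>\<^sub>\<alpha> + M (\<delta>\<^sub>1 + \<delta>\<^sub>-\<^sub>1)\<close> is given by its values on
  sets; \<open>indicator A x\<close> is \<open>\<delta>\<^sub>x(A)\<close>.\<close>

definition jacobi_mass_measure :: "real \<Rightarrow> real \<Rightarrow> real measure" where
  "jacobi_mass_measure \<alpha> M = measure_of {-1..1} (sets (lebesgue_on {-1..1}))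
     (\<lambda>A. emeasure (jacobi_measure \<alpha>) A + ennreal M * (indicator A 1 + indicator A (-1)))"

text \<open>Functions on \<open>[-1,1]\<close> are represented by total functions on the reals. Their values
  outside \<open>[-1,1]\<close> play no role: neither measurability, nor the norms, nor the one-sided
  derivatives, nor the equivalence relation below depend on them.

  All norms take values in \<open>[0,\<infinity>]\<close>, so an infinite norm is not confused with \<open>0\<close>.\<close>

definition Lp_power :: "'a measure \<Rightarrow> real \<Rightarrow> ('a \<Rightarrow> real) \<Rightarrow> ennreal" where
  "Lp_power \<mu> p f = (\<integral>\<^sup>+x. ennreal (\<bar>f x\<bar> powr p) \<partial>\<mu>)"

definition ennreal_root :: "real \<Rightarrow> ennreal \<Rightarrow> ennreal" where
  "ennreal_root p t = (if t = \<infinity> then \<infinity> else ennreal (enn2real t powr (1 / p)))"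

definition Lp_norm :: "'a measure \<Rightarrow> real \<Rightarrow> ('a \<Rightarrow> real) \<Rightarrow> ennreal" where
  "Lp_norm \<mu> p f = ennreal_root p (Lp_power \<mu> p f)"

definition Lp_rel :: "'a measure \<Rightarrow> real \<Rightarrow> (('a \<Rightarrow> real) \<times> ('a \<Rightarrow> real)) set" where
  "Lp_rel \<mu> p = {(f, g). f \<in> borel_measurable \<mu> \<and> g \<in> borel_measurable \<mu> \<and>
     Lp_norm \<mu> p (\<lambda>x. f x - g x) = 0}"

definition has_end_derivs :: "(real \<Rightarrow> real) \<Rightarrow> bool" where
  "has_end_derivs f \<longleftrightarrow>
     f differentiable (at 1 within {-1..1}) \<and> f differentiable (at (-1) within {-1..1})"

abbreviation end_deriv :: "(real \<Rightarrow> real) \<Rightarrow> real \<Rightarrow> real" where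
  "end_deriv f a \<equiv> vector_derivative f (at a within {-1..1})"

text \<open>The \<open>p\<close>-th power of the norm of a function \<open>f\<close> with \<open>has_end_derivs f\<close>; its first summand
  \<open>Lp_power\<close> is the \<open>p\<close>-th power of \<open>Lp_norm\<close>.\<close>

definition W_power :: "real \<Rightarrow> real \<Rightarrow> real \<Rightarrow> real \<Rightarrow> (real \<Rightarrow> real) \<Rightarrow> ennreal" where
  "W_power \<alpha> p M N f = Lp_power (jacobi_measure \<alpha>) p f
     + ennreal (M * (\<bar>f 1\<bar> powr p + \<bar>f (-1)\<bar> powr p)
              + N * (\<bar>end_deriv f 1\<bar> powr p + \<bar>end_deriv f (-1)\<bar> powr p))"

definition W_space :: "real \<Rightarrow> real \<Rightarrow> real \<Rightarrow> real \<Rightarrow> (real \<Rightarrow> real) set set" where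
  "W_space \<alpha> p M N =
     {F \<in> borel_measurable (jacobi_mass_measure \<alpha> M) // Lp_rel (jacobi_mass_measure \<alpha> M) p.
        \<exists>f\<in>F. has_end_derivs f \<and> W_power \<alpha> p M N f < \<infinity>}"

text \<open>The norm of a class is that of any representative having the derivatives at \<open>\<plusminus>1\<close>; that the
  choice does not matter is lemma \<open>W_power_cong\<close> below.\<close>

definition W_norm :: "real \<Rightarrow> real \<Rightarrow> real \<Rightarrow> real \<Rightarrow> (real \<Rightarrow> real) set \<Rightarrow> ennreal" where
  "W_norm \<alpha> p M N F = ennreal_root p (W_power \<alpha> p M N (SOME f. f \<in> F \<and> has_end_derivs f))"

definition class_of :: "real \<Rightarrow> real \<Rightarrow> real \<Rightarrow> (real \<Rightarrow> real) \<Rightarrow> (real \<Rightarrow> real) set" where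
  "class_of \<alpha> p M f = Lp_rel (jacobi_mass_measure \<alpha> M) p `` {f}"

definition class_diff :: "(real \<Rightarrow> real) set \<Rightarrow> (real \<Rightarrow> real) set \<Rightarrow> (real \<Rightarrow> real) set" where
  "class_diff F G = {\<lambda>x. f x - g x | f g. f \<in> F \<and> g \<in> G}"

lemma space_jacobi_measure [simp]: "space (jacobi_measure \<alpha>) = {-1..1}"
  and sets_jacobi_measure [simp, measurable_cong]:
    "sets (jacobi_measure \<alpha>) = sets (lebesgue_on {-1..1})"
  by (simp_all add: jacobi_measure_def)

lemma sets_lebesgue_on_subset: "sets (lebesgue_on {-1..1::real}) \<subseteq> Pow {-1..1}"
  using sets.sets_into_space[of _ "lebesgue_on {-1..1::real}"] by auto

lemma sigma_sets_lebesgue_on: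
  "sigma_sets {-1..1::real} (sets (lebesgue_on {-1..1})) = sets (lebesgue_on {-1..1})"
  using sets.sigma_sets_eq[of "lebesgue_on {-1..1::real}"] by simp

lemma space_jacobi_mass_measure [simp]: "space (jacobi_mass_measure \<alpha> M) = {-1..1}"
  and sets_jacobi_mass_measure [simp, measurable_cong]:
    "sets (jacobi_mass_measure \<alpha> M) = sets (lebesgue_on {-1..1})"
  using sets_lebesgue_on_subset sigma_sets_lebesgue_on
  by (simp_all add: jacobi_mass_measure_def)

lemma emeasure_jacobi_mass_measure:
  assumes "A \<in> sets (lebesgue_on {-1..1})"
  shows "emeasure (jacobi_mass_measure \<alpha> M) A
    = emeasure (jacobi_measure \<alpha>) A + ennreal M * (indicator A 1 + indicator A (-1))"
proof (rule emeasure_measure_of[OF jacobi_mass_measure_def sets_lebesgue_on_subset])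
  show "A \<in> sets (jacobi_mass_measure \<alpha> M)" using assms by simp
  show "positive (sets (jacobi_mass_measure \<alpha> M)) (\<lambda>A. emeasure (jacobi_measure \<alpha>) A
      + ennreal M * (indicator A 1 + indicator A (-1)))"
    by (simp add: positive_def)
  show "countably_additive (sets (jacobi_mass_measure \<alpha> M)) (\<lambda>A. emeasure (jacobi_measure \<alpha>) A
      + ennreal M * (indicator A 1 + indicator A (-1)))"
  proof (rule countably_additiveI)
    fix A :: "nat \<Rightarrow> real set"
    assume A: "range A \<subseteq> sets (jacobi_mass_measure \<alpha> M)" "disjoint_family A"
    have "(\<Sum>i. emeasure (jacobi_measure \<alpha>) (A i)) = emeasure (jacobi_measure \<alpha>) (\<Union>i. A i)"
      using A by (intro suminf_emeasure) auto
    moreover have "(\<Sum>i. indicator (A i) x :: ennreal) = indicator (\<Union>i. A i) x" for x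
      by (rule suminf_indicator[OF A(2)])
    ultimately show "(\<Sum>i. emeasure (jacobi_measure \<alpha>) (A i)
          + ennreal M * (indicator (A i) 1 + indicator (A i) (-1)))
        = emeasure (jacobi_measure \<alpha>) (\<Union>i. A i)
          + ennreal M * (indicator (\<Union>i. A i) 1 + indicator (\<Union>i. A i) (-1))"
      by (simp add: suminf_add[symmetric])
  qed
qed

lemma ennreal_root_eq_0_iff: "ennreal_root p t = 0 \<longleftrightarrow> t = 0"
  by (auto simp: ennreal_root_def ennreal_eq_0_iff enn2real_eq_0_iff)

lemma Lp_rel_iff_AE:
  "(f, g) \<in> Lp_rel \<mu> p \<longleftrightarrow>
     f \<in> borel_measurable \<mu> \<and> g \<in> borel_measurable \<mu> \<and> (AE x in \<mu>. f x = g x)"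
  by (auto simp: Lp_rel_def Lp_norm_def ennreal_root_eq_0_iff Lp_power_def nn_integral_0_iff_AE
      ennreal_eq_0_iff)

lemma equiv_Lp_rel: "equiv (borel_measurable \<mu>) (Lp_rel \<mu> p)"
  by (rule equivI) (auto simp: refl_on_def sym_def trans_def Lp_rel_iff_AE elim: AE_mp)

lemma AE_jacobi_mass_measureD:
  assumes "AE x in jacobi_mass_measure \<alpha> M. P x"
  shows "AE x in jacobi_measure \<alpha>. P x"
proof -
  obtain S where S: "{x \<in> space (jacobi_mass_measure \<alpha> M). \<not> P x} \<subseteq> S"
    "emeasure (jacobi_mass_measure \<alpha> M) S = 0" "S \<in> sets (jacobi_mass_measure \<alpha> M)"
    using assms by (rule AE_E)
  show ?thesis
    by (rule AE_I[of _ _ S]) (use S in \<open>auto simp: emeasure_jacobi_mass_measure\<close>)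
qed

lemma AE_jacobi_measureD:
  assumes "AE x in jacobi_measure \<alpha>. P x" "\<alpha> > -1"
  shows "AE x in lebesgue. x \<in> {-1<..<1} \<longrightarrow> P x"
proof -
  have "Gamma (2 * \<alpha> + 2) / (2 powr (2 * \<alpha> + 1) * (Gamma (\<alpha> + 1))\<^sup>2) > 0"
    using assms(2) by (intro divide_pos_pos mult_pos_pos zero_less_power Gamma_real_pos) auto
  moreover have "(1 - x\<^sup>2) powr \<alpha> > 0" if "x \<in> {-1<..<1}" for x :: real
    using that abs_square_less_1[of x] by auto
  ultimately have pos: "Gamma (2 * \<alpha> + 2) / (2 powr (2 * \<alpha> + 1) * (Gamma (\<alpha> + 1))\<^sup>2)
      * (1 - x\<^sup>2) powr \<alpha> > 0" if "x \<in> {-1<..<1}" for x :: real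
    using that by (meson mult_pos_pos)
  have "(\<lambda>x::real. ennreal (Gamma (2 * \<alpha> + 2) / (2 powr (2 * \<alpha> + 1) * (Gamma (\<alpha> + 1))\<^sup>2)
      * (1 - x\<^sup>2) powr \<alpha>)) \<in> borel_measurable (lebesgue_on {-1..1})"
    by (intro measurable_restrict_space1 measurable_completion) simp
  from assms(1)[unfolded jacobi_measure_def AE_density[OF this]]
  have "AE x in lebesgue_on {-1..1}. x \<in> {-1<..<1} \<longrightarrow> P x"
    by (rule AE_mp) (use pos in \<open>auto simp: ennreal_eq_0_iff intro!: AE_I2\<close>)
  then show ?thesis
    by (subst (asm) AE_restrict_space_iff) (auto elim: AE_mp)
qed

lemma islimpt_agree:
  fixes a b :: real
  assumes "AE x in lebesgue. x \<in> {a<..<b} \<longrightarrow> P x" "a < b" "c \<in> {a..b}"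
  shows "c islimpt {x \<in> {a<..<b}. P x}"
proof (rule islimptI)
  fix T :: "real set" assume T: "c \<in> T" "open T"
  have "c \<in> closure {a<..<b}" using assms by simp
  then have "T \<inter> {a<..<b} \<noteq> {}"
    using T by (metis Int_commute closure_iff_nhds_not_empty order_refl)
  then have ne: "open (T \<inter> {a<..<b})" "T \<inter> {a<..<b} \<noteq> {}" using T by auto
  have N: "negligible {x. \<not> (x \<in> {a<..<b} \<longrightarrow> P x)}"
    using assms(1) by (auto simp: eventually_ae_filter negligible_iff_null_sets
        intro: negligible_subset[unfolded negligible_iff_null_sets])
  show "\<exists>y\<in>{x \<in> {a<..<b}. P x}. y \<in> T \<and> y \<noteq> c"
  proof (rule ccontr)
    assume "\<not> ?thesis"
    then have "T \<inter> {a<..<b} \<subseteq> {x. \<not> (x \<in> {a<..<b} \<longrightarrow> P x)} \<union> {c}" by auto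
    moreover have "negligible ({x. \<not> (x \<in> {a<..<b} \<longrightarrow> P x)} \<union> {c})"
      using N by (intro negligible_Un negligible_sing)
    ultimately have "negligible (T \<inter> {a<..<b})" by (rule negligible_subset[rotated])
    then show False using open_not_negligible[OF ne] by blast
  qed
qed

lemma end_value_eq:
  fixes f g :: "real \<Rightarrow> real"
  assumes "f differentiable (at c within S)" "g differentiable (at c within S)"
    and "c islimpt {x \<in> S. f x = g x}" "c \<in> S"
  shows "f c = g c"
    and "vector_derivative f (at c within S) = vector_derivative g (at c within S)"
proof -
  define D where "D = {x \<in> S. f x = g x}"
  have nt: "at c within D \<noteq> bot" using assms(3) by (simp add: D_def trivial_limit_within)
  have DS: "D \<subseteq> S" by (auto simp: D_def)
  have ev: "eventually (\<lambda>x. f x = g x) (at c within D)"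
    by (auto simp: D_def eventually_at_filter)
  have "(f \<longlongrightarrow> f c) (at c within D)" "(g \<longlongrightarrow> g c) (at c within D)"
    using assms(1,2) DS differentiable_imp_continuous_within
    by (metis continuous_within tendsto_within_subset)+
  with ev nt show eq: "f c = g c"
    by (metis (mono_tags, lifting) tendsto_cong tendsto_unique)
  have "(f has_vector_derivative vector_derivative f (at c within S)) (at c within D)"
    "(g has_vector_derivative vector_derivative g (at c within S)) (at c within D)"
    using assms(1,2) DS
    by (metis has_vector_derivative_within_subset vector_derivative_works)+
  moreover from this(2)
  have "(f has_vector_derivative vector_derivative g (at c within S)) (at c within D)"
    by (rule has_vector_derivative_weaken[where S = D])
       (use eq assms(4) in \<open>auto simp: D_def\<close>)
  ultimately show
    "vector_derivative f (at c within S) = vector_derivative g (at c within S)"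
    using nt vector_derivative_unique_within by blast
qed

lemma W_power_cong:
  assumes "\<alpha> > -1" "(f, g) \<in> Lp_rel (jacobi_mass_measure \<alpha> M) p"
    and "has_end_derivs f" "has_end_derivs g"
  shows "W_power \<alpha> p M N f = W_power \<alpha> p M N g"
proof -
  have AE: "AE x in jacobi_measure \<alpha>. f x = g x"
    using assms(2) AE_jacobi_mass_measureD by (auto simp: Lp_rel_iff_AE)
  have lim: "c islimpt {x \<in> {-1..1}. f x = g x}" if "c \<in> {-1..1}" for c
    by (rule islimpt_subset[OF islimpt_agree[OF AE_jacobi_measureD[OF AE assms(1)] _ that]]) auto
  have "Lp_power (jacobi_measure \<alpha>) p f = Lp_power (jacobi_measure \<alpha>) p g"
    unfolding Lp_power_def using AE by (intro nn_integral_cong_AE) auto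
  moreover have "f 1 = g 1" "end_deriv f 1 = end_deriv g 1"
    "f (-1) = g (-1)" "end_deriv f (-1) = end_deriv g (-1)"
    using assms(3,4) lim[of 1] lim[of "-1"] end_value_eq
    unfolding has_end_derivs_def by auto
  ultimately show ?thesis by (simp add: W_power_def)
qed

lemma W_norm_eq:
  assumes "\<alpha> > -1" "F \<in> borel_measurable (jacobi_mass_measure \<alpha> M)
             // Lp_rel (jacobi_mass_measure \<alpha> M) p"
    and "f \<in> F" "has_end_derivs f"
  shows "W_norm \<alpha> p M N F = ennreal_root p (W_power \<alpha> p M N f)"
proof -
  define g where "g = (SOME f. f \<in> F \<and> has_end_derivs f)"
  have g: "g \<in> F" "has_end_derivs g"
    unfolding g_def using someI[of "\<lambda>f. f \<in> F \<and> has_end_derivs f" f] assms(3,4) by auto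
  have "(g, f) \<in> Lp_rel (jacobi_mass_measure \<alpha> M) p"
    using quotient_eq_iff[OF equiv_Lp_rel assms(2) assms(2) g(1) assms(3)] by simp
  then have "W_power \<alpha> p M N g = W_power \<alpha> p M N f"
    by (rule W_power_cong[OF assms(1) _ g(2) assms(4)])
  then show ?thesis by (simp add: W_norm_def g_def)
qed

text \<open>\<open>class_diff\<close> is the subtraction induced on the quotient.\<close>

lemma class_diff_class_of:
  assumes "f \<in> borel_measurable (jacobi_mass_measure \<alpha> M)"
    "g \<in> borel_measurable (jacobi_mass_measure \<alpha> M)"
  shows "class_diff (class_of \<alpha> p M f) (class_of \<alpha> p M g) = class_of \<alpha> p M (\<lambda>x. f x - g x)"
proof (intro equalityI subsetI)
  fix h assume "h \<in> class_diff (class_of \<alpha> p M f) (class_of \<alpha> p M g)"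
  then obtain u v where uv: "h = (\<lambda>x. u x - v x)"
    "(f, u) \<in> Lp_rel (jacobi_mass_measure \<alpha> M) p" "(g, v) \<in> Lp_rel (jacobi_mass_measure \<alpha> M) p"
    by (auto simp: class_diff_def class_of_def)
  then have "AE x in jacobi_mass_measure \<alpha> M. f x - g x = h x"
    unfolding Lp_rel_iff_AE by (auto elim: AE_mp)
  with uv assms show "h \<in> class_of \<alpha> p M (\<lambda>x. f x - g x)"
    by (auto simp: class_of_def Lp_rel_iff_AE)
next
  fix h assume h: "h \<in> class_of \<alpha> p M (\<lambda>x. f x - g x)"
  then have "AE x in jacobi_mass_measure \<alpha> M. f x = h x + g x"
    unfolding class_of_def Lp_rel_iff_AE Image_singleton_iff by (auto elim: AE_mp)
  with h assms have "(\<lambda>x. h x + g x) \<in> class_of \<alpha> p M f" "g \<in> class_of \<alpha> p M g"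
    by (auto simp: class_of_def Lp_rel_iff_AE)
  moreover have "h = (\<lambda>x. (h x + g x) - g x)" by simp
  ultimately show "h \<in> class_diff (class_of \<alpha> p M f) (class_of \<alpha> p M g)"
    unfolding class_diff_def mem_Collect_eq by (intro exI conjI)
qed

end

theory Submission
  imports Defs
begin

text \<open>Subtracting the cubic Hermite interpolant at \<open>\<plusminus>1\<close> and looking only for approximants
  \<open>(1 - x\<^sup>2)\<^sup>2 q(x)\<close>, which vanish to second order at \<open>\<plusminus>1\<close>, makes the boundary terms of the norm
  exactly zero. So it suffices that \<open>(1 - x\<^sup>2)\<^sup>2 q(x)\<close>, with \<open>q\<close> a polynomial, are dense in
  \<open>L\<^sup>p(\<mu>\<^sub>\<alpha>)\<close>. For \<open>g\<close> in this space one truncates \<open>g / (1 - x\<^sup>2)\<^sup>2\<close> to a bounded function and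
  approximates that function almost everywhere by continuous functions (Lusin), hence by
  polynomials (Weierstrass), using dominated convergence.\<close>

section \<open>Estimates for the p-th power of the \<open>L^p\<close> norm\<close>

text \<open>Pointwise, \<open>\<bar>a + b\<bar>\<close> is at most twice the larger of the two
  absolute values. This replaces Minkowski's inequality: the factor \<open>2 powr p\<close> is
  harmless, since both summands can be made arbitrarily small.\<close>

lemma Lp_power_add_le:
  assumes "f \<in> borel_measurable \<mu>" "g \<in> borel_measurable \<mu>" "p > 0"
  shows "Lp_power \<mu> p (\<lambda>x. f x + g x) \<le> ennreal (2 powr p) * (Lp_power \<mu> p f + Lp_power \<mu> p g)"
proof -
  have bound: "\<bar>a + b\<bar> powr p \<le> 2 powr p * (\<bar>a\<bar> powr p + \<bar>b\<bar> powr p)" for a b :: real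
  proof -
    have "\<bar>a + b\<bar> powr p \<le> (2 * max \<bar>a\<bar> \<bar>b\<bar>) powr p"
      using assms(3) by (intro powr_mono2) auto
    also have "\<dots> = 2 powr p * max \<bar>a\<bar> \<bar>b\<bar> powr p"
      by (simp add: powr_mult)
    also have "max \<bar>a\<bar> \<bar>b\<bar> powr p \<le> \<bar>a\<bar> powr p + \<bar>b\<bar> powr p"
      by (auto simp: max_def)
    finally show ?thesis by simp
  qed
  have "Lp_power \<mu> p (\<lambda>x. f x + g x)
      \<le> (\<integral>\<^sup>+x. ennreal (2 powr p) * (ennreal (\<bar>f x\<bar> powr p) + ennreal (\<bar>g x\<bar> powr p)) \<partial>\<mu>)"
    unfolding Lp_power_def
    by (intro nn_integral_mono) (simp add: bound ennreal_leI flip: ennreal_plus ennreal_mult)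
  also have "\<dots> = ennreal (2 powr p) * (Lp_power \<mu> p f + Lp_power \<mu> p g)"
    unfolding Lp_power_def using assms(1,2)
    by (subst nn_integral_cmult) (auto simp: nn_integral_add)
  finally show ?thesis .
qed

lemma Lp_power_le_cmult:
  assumes "f \<in> borel_measurable \<mu>" "p > 0" "\<And>x. x \<in> space \<mu> \<Longrightarrow> \<bar>g x\<bar> \<le> C * \<bar>f x\<bar>" "C \<ge> 0"
  shows "Lp_power \<mu> p g \<le> ennreal (C powr p) * Lp_power \<mu> p f"
proof -
  have "Lp_power \<mu> p g \<le> (\<integral>\<^sup>+x. ennreal (C powr p) * ennreal (\<bar>f x\<bar> powr p) \<partial>\<mu>)"
    unfolding Lp_power_def
  proof (rule nn_integral_mono)
    fix x assume "x \<in> space \<mu>"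
    then have "\<bar>g x\<bar> powr p \<le> (C * \<bar>f x\<bar>) powr p"
      using assms by (intro powr_mono2) auto
    then show "ennreal (\<bar>g x\<bar> powr p) \<le> ennreal (C powr p) * ennreal (\<bar>f x\<bar> powr p)"
      using assms(4) by (simp add: powr_mult ennreal_leI flip: ennreal_mult)
  qed
  also have "\<dots> = ennreal (C powr p) * Lp_power \<mu> p f"
    unfolding Lp_power_def using assms(1) by (intro nn_integral_cmult) simp
  finally show ?thesis .
qed

lemma Lp_power_bounded_finite:
  assumes "finite_measure \<mu>" "p > 0" "\<And>x. x \<in> space \<mu> \<Longrightarrow> \<bar>g x\<bar> \<le> C" "C \<ge> 0"
  shows "Lp_power \<mu> p g < \<infinity>"
proof -
  have "Lp_power \<mu> p g \<le> ennreal (C powr p) * Lp_power \<mu> p (\<lambda>_. 1)"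
    using assms by (intro Lp_power_le_cmult) auto
  also have "\<dots> < \<infinity>"
    using finite_measure.emeasure_finite[OF assms(1)]
    by (simp add: Lp_power_def ennreal_mult_less_top less_top)
  finally show ?thesis .
qed

text \<open>Dominated convergence for the p-th powers, with \<open>\<bar>k x\<bar> powr p\<close> as
  integrable majorant.\<close>

lemma Lp_power_tendsto_0:
  assumes "\<And>n. h n \<in> borel_measurable \<mu>" "k \<in> borel_measurable \<mu>" "p > 0"
    and "\<And>n x. x \<in> space \<mu> \<Longrightarrow> \<bar>h n x\<bar> \<le> \<bar>k x\<bar>" "Lp_power \<mu> p k < \<infinity>"
    and "AE x in \<mu>. (\<lambda>n. h n x) \<longlonglongrightarrow> (0::real)"
  shows "(\<lambda>n. Lp_power \<mu> p (h n)) \<longlonglongrightarrow> 0"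
proof -
  have "(\<lambda>n. \<integral>\<^sup>+x. ennreal (\<bar>h n x\<bar> powr p) \<partial>\<mu>) \<longlonglongrightarrow> (\<integral>\<^sup>+x. 0 \<partial>\<mu>)"
  proof (rule nn_integral_dominated_convergence)
    show "AE x in \<mu>. ennreal (\<bar>h n x\<bar> powr p) \<le> ennreal (\<bar>k x\<bar> powr p)" for n
      using assms by (intro AE_I2 ennreal_leI powr_mono2) auto
    show "AE x in \<mu>. (\<lambda>n. ennreal (\<bar>h n x\<bar> powr p)) \<longlonglongrightarrow> 0"
      using assms(6)
    proof eventually_elim
      case (elim x)
      then have "(\<lambda>n. \<bar>h n x\<bar> powr p) \<longlonglongrightarrow> 0"
        using assms(3) tendsto_rabs_zero
        by (intro tendsto_zero_powrI[where b = p]) auto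
      then show ?case
        using tendsto_ennrealI by fastforce
    qed
  qed (use assms in \<open>auto simp: Lp_power_def\<close>)
  then show ?thesis by (simp add: Lp_power_def)
qed

section \<open>Polynomial approximation in \<open>L^p\<close> on a compact interval\<close>

lemma uniform_polynomial_approx:
  fixes f :: "real \<Rightarrow> real"
  assumes "continuous_on {a..b} f" "e > 0"
  obtains q where "\<And>x. x \<in> {a..b} \<Longrightarrow> \<bar>f x - poly q x\<bar> < e"
proof -
  obtain g where g: "real_polynomial_function g" "\<And>x. x \<in> {a..b} \<Longrightarrow> \<bar>f x - g x\<bar> < e"
    using Stone_Weierstrass_real_polynomial_function[OF compact_Icc assms] by metis
  obtain c n where "g = (\<lambda>x. \<Sum>i\<le>n. c i * x ^ i)"
    using g(1) unfolding real_polynomial_function_iff_sum by metis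
  then have "g = poly (\<Sum>i\<le>n. monom (c i) i)"
    by (auto simp: poly_sum poly_monom)
  with g(2) show thesis by (intro that) blast
qed

text \<open>Measurability depends only on the sigma-algebra, so one statement serves both
  \<open>jacobi_measure\<close> and \<open>jacobi_mass_measure\<close>.\<close>

lemma poly_borel_measurable_lebesgue_on:
  fixes q :: "real poly"
  assumes "sets \<mu> = sets (lebesgue_on S)"
  shows "poly q \<in> borel_measurable \<mu>"
proof -
  have "poly q \<in> borel_measurable (lebesgue_on S)"
    by (intro measurable_restrict_space1 measurable_completion)
       (use continuous_on_poly[OF continuous_on_id, of UNIV q] in \<open>simp add: borel_measurable_continuous_onI\<close>)
  then show ?thesis using measurable_cong_sets[OF assms refl] by auto
qed

text \<open>A Lebesgue measurable function is a limit of continuous functions outside a negligible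
  set, and \<open>ac\<close> makes that set null for \<open>\<mu>\<close> as well. Finiteness of
  \<open>\<mu>\<close> makes a constant majorant integrable.\<close>

lemma polynomials_Lp_approx_bounded:
  fixes \<mu> :: "real measure"
  assumes fin: "finite_measure \<mu>" and sets: "sets \<mu> = sets (lebesgue_on {a..b})"
    and ac: "\<And>P. (AE x in lebesgue_on {a..b}. P x) \<Longrightarrow> (AE x in \<mu>. P x)"
    and p: "p > 0" and h: "h \<in> borel_measurable \<mu>" and K: "\<And>x. \<bar>h x\<bar> \<le> K" and "\<delta> > 0"
  shows "\<exists>q. Lp_power \<mu> p (\<lambda>x. h x - poly q x) < \<delta>"
proof -
  have space: "space \<mu> = {a..b}" using sets_eq_imp_space_eq[OF sets] by simp
  have "K \<ge> 0" using K[of 0] by linarith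
  have "h \<in> borel_measurable (lebesgue_on {a..b})"
    using h measurable_cong_sets[OF sets refl] by auto
  then have "h measurable_on {a..b}"
    by (intro measurable_on_iff_borel_measurable[THEN iffD2]) auto
  then obtain N g where g: "negligible N" "\<And>n. continuous_on UNIV (g n)"
    "\<And>x. x \<notin> N \<Longrightarrow> (\<lambda>n. g n x) \<longlonglongrightarrow> (if x \<in> {a..b} then h x else 0)"
    unfolding measurable_on_def by metis
  \<comment> \<open>Clamping to \<open>[-K, K]\<close> keeps continuity, gives a bound uniform in
    \<open>n\<close>, and preserves the limit because \<open>h\<close> itself lies in this
    range.\<close>
  define c where "c n x = max (-K) (min K (g n x))" for n x
  have cont: "continuous_on {a..b} (c n)" for n
    unfolding c_def using continuous_on_subset[OF g(2)] by (intro continuous_intros) auto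
  have "\<exists>q. \<forall>x\<in>{a..b}. \<bar>c n x - poly q x\<bar> < inverse (real (Suc n))" for n
    by (rule uniform_polynomial_approx[OF cont, of "inverse (real (Suc n))" n]) (simp, blast)
  then obtain q where q: "\<And>n x. x \<in> {a..b} \<Longrightarrow> \<bar>c n x - poly (q n) x\<bar> < inverse (real (Suc n))"
    by metis
  have "(\<lambda>n. Lp_power \<mu> p (\<lambda>x. h x - poly (q n) x)) \<longlonglongrightarrow> 0"
  \<comment> \<open>The majorant adds \<open>K\<close> for \<open>h\<close>, \<open>K\<close> for
    \<open>c n\<close> and 1 for the Weierstrass error.\<close>
  proof (rule Lp_power_tendsto_0[where k = "\<lambda>_. 2 * K + 1"])
    show "(\<lambda>x. h x - poly (q n) x) \<in> borel_measurable \<mu>" for n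
      using h poly_borel_measurable_lebesgue_on[OF sets] by simp
    show "Lp_power \<mu> p (\<lambda>_. 2 * K + 1) < \<infinity>"
      using \<open>K \<ge> 0\<close> by (intro Lp_power_bounded_finite[OF fin p, of _ "2 * K + 1"]) auto
    show "\<bar>h x - poly (q n) x\<bar> \<le> \<bar>2 * K + 1\<bar>" if "x \<in> space \<mu>" for n x
    proof -
      have "\<bar>c n x - poly (q n) x\<bar> < inverse (real (Suc n))" using q that space by simp
      also have "\<dots> \<le> 1" by (simp add: field_simps)
      finally have "\<bar>c n x - poly (q n) x\<bar> < 1" .
      moreover have "\<bar>c n x\<bar> \<le> K" using \<open>K \<ge> 0\<close> by (auto simp: c_def)
      ultimately show ?thesis using K[of x] by linarith
    qed
    have "AE x in lebesgue. x \<notin> N"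
      using g(1) by (simp add: negligible_iff_null_sets AE_not_in)
    then have "AE x in lebesgue_on {a..b}. x \<notin> N"
      by (subst AE_restrict_space_iff) (auto elim: AE_mp)
    then have "AE x in \<mu>. x \<notin> N" by (rule ac)
    then show "AE x in \<mu>. (\<lambda>n. h x - poly (q n) x) \<longlonglongrightarrow> 0"
      using AE_space
    proof eventually_elim
      case (elim x)
      then have x: "x \<in> {a..b}" using space by simp
      have "(\<lambda>n. g n x) \<longlonglongrightarrow> h x" using g(3)[OF elim(1)] x by simp
      then have "(\<lambda>n. c n x) \<longlonglongrightarrow> max (-K) (min K (h x))"
        unfolding c_def by (intro tendsto_intros)
      moreover have "max (-K) (min K (h x)) = h x" using K[of x] by auto
      ultimately have "(\<lambda>n. h x - c n x) \<longlonglongrightarrow> 0"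
        using tendsto_diff[OF tendsto_const[of "h x"], of "\<lambda>n. c n x" "h x"] by simp
      moreover have "(\<lambda>n. c n x - poly (q n) x) \<longlonglongrightarrow> 0"
        by (rule Lim_null_comparison[OF _ LIMSEQ_inverse_real_of_nat])
           (use q[OF x] in \<open>auto intro!: always_eventually less_imp_le\<close>)
      ultimately have "(\<lambda>n. (h x - c n x) + (c n x - poly (q n) x)) \<longlonglongrightarrow> 0 + 0"
        by (rule tendsto_add)
      then show ?case by simp
    qed
  qed (use p in auto)
  then have "eventually (\<lambda>n. Lp_power \<mu> p (\<lambda>x. h x - poly (q n) x) < \<delta>) sequentially"
    using \<open>\<delta> > 0\<close> by (rule order_tendstoD)
  then show ?thesis by (meson eventually_happens' sequentially_bot)
qed

text \<open>With \<open>t n\<close> the truncation of \<open>f / w\<close> at height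
  \<open>n\<close>, the error splits as \<open>f - w * q = (f - w * t n) + w * (t n - q)\<close>.
  The first part tends to 0 with majorant \<open>f\<close>; the second is small because
  \<open>t n\<close> is bounded and \<open>w\<close> is bounded on the interval.\<close>

lemma weighted_polynomials_Lp_dense:
  fixes \<mu> :: "real measure" and \<delta> :: ennreal
  assumes fin: "finite_measure \<mu>" and sets: "sets \<mu> = sets (lebesgue_on {a..b})"
    and ac: "\<And>P. (AE x in lebesgue_on {a..b}. P x) \<Longrightarrow> (AE x in \<mu>. P x)"
    and p: "p > 0" and f: "f \<in> borel_measurable \<mu>" "Lp_power \<mu> p f < \<infinity>" and "\<delta> > 0"
    and w: "AE x in \<mu>. poly w x \<noteq> 0"
  shows "\<exists>q. Lp_power \<mu> p (\<lambda>x. f x - poly (w * q) x) < \<delta>"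
proof -
  have space: "space \<mu> = {a..b}" using sets_eq_imp_space_eq[OF sets] by simp
  note [measurable] = poly_borel_measurable_lebesgue_on[OF sets] f(1)
  define t where "t n x = max (- real n) (min (real n) (f x / poly w x))" for n x
  have t_meas [measurable]: "t n \<in> borel_measurable \<mu>" for n
    unfolding t_def by measurable
  have t_bound: "\<bar>t n x\<bar> \<le> real n" for n x unfolding t_def by auto
  have "(\<lambda>n. Lp_power \<mu> p (\<lambda>x. f x - poly w x * t n x)) \<longlonglongrightarrow> 0"
  proof (rule Lp_power_tendsto_0[OF _ f(1) p _ f(2)])
    show "\<bar>f x - poly w x * t n x\<bar> \<le> \<bar>f x\<bar>" for n x
    proof (cases "poly w x = 0")
      case False
      then have "f x - poly w x * t n x = poly w x * (f x / poly w x - t n x)"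
        by (simp add: field_simps)
      \<comment> \<open>Truncation moves a value towards 0 without crossing it, so the removed part
        is no larger than the value.\<close>
      moreover have "\<bar>f x / poly w x - t n x\<bar> \<le> \<bar>f x / poly w x\<bar>"
        unfolding t_def by (simp add: max_def min_def abs_if)
      ultimately have "\<bar>f x - poly w x * t n x\<bar> \<le> \<bar>poly w x\<bar> * \<bar>f x / poly w x\<bar>"
        by (simp add: abs_mult mult_left_mono del: abs_divide)
      moreover have "\<bar>poly w x\<bar> * \<bar>f x / poly w x\<bar> = \<bar>f x\<bar>" using False by simp
      ultimately show ?thesis by simp
    qed simp
    show "AE x in \<mu>. (\<lambda>n. f x - poly w x * t n x) \<longlonglongrightarrow> 0"
      using w
    proof eventually_elim
      case (elim x)
      \<comment> \<open>Once \<open>n\<close> exceeds the size of the quotient at \<open>x\<close>,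
        truncation is inactive and the error is exactly 0.\<close>
      obtain m where m: "\<bar>f x / poly w x\<bar> \<le> real m" using real_arch_simple by blast
      have "t n x = f x / poly w x" if "n \<ge> m" for n
        using m of_nat_mono[OF that, where 'a = real] unfolding t_def by linarith
      then have "eventually (\<lambda>n. f x - poly w x * t n x = 0) sequentially"
        using elim by (auto simp: eventually_sequentially intro!: exI[of _ m])
      then show ?case by (rule tendsto_eventually)
    qed
  qed measurable
  \<comment> \<open>\<open>\<delta>\<close> may be infinite; taking the minimum with 1 gives a real
    bound to divide.\<close>
  obtain d where d: "min 1 \<delta> = ennreal d" "d \<ge> 0"
    by (cases "min 1 \<delta>") (auto simp: min_def top_unique split: if_splits)
  then have "d > 0" using \<open>\<delta> > 0\<close> by (cases "d = 0") (auto simp: min_def split: if_splits)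
  define E where "E = 2 powr p"
  have E: "E > 0" by (simp add: E_def)
  \<comment> \<open>Each of the two errors gets the share \<open>\<eta>\<close>, chosen so that
    \<open>E * (\<eta> + \<eta>) = d\<close>, where \<open>E\<close> is the factor in
    \<open>Lp_power_add_le\<close>.\<close>
  define \<eta> where "\<eta> = ennreal (d / (2 * E))"
  have \<eta>: "\<eta> > 0" using \<open>d > 0\<close> E by (simp add: \<eta>_def)
  have "eventually (\<lambda>n. Lp_power \<mu> p (\<lambda>x. f x - poly w x * t n x) < \<eta>) sequentially"
    using \<open>(\<lambda>n. Lp_power \<mu> p _) \<longlonglongrightarrow> 0\<close> \<eta> by (rule order_tendstoD)
  then obtain n where n: "Lp_power \<mu> p (\<lambda>x. f x - poly w x * t n x) < \<eta>"
    by (meson eventually_happens' sequentially_bot)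
  have "bounded (poly w ` {a..b})"
    by (intro compact_imp_bounded compact_continuous_image continuous_on_poly[OF continuous_on_id]) simp
  then obtain C where C: "C > 0" "\<And>x. x \<in> {a..b} \<Longrightarrow> \<bar>poly w x\<bar> \<le> C"
    unfolding bounded_pos by auto
  \<comment> \<open>Dividing by \<open>C powr p\<close> compensates for the later multiplication by
    \<open>w\<close>, which is bounded by \<open>C\<close>.\<close>
  have "ennreal (d / (2 * E) / C powr p) > 0"
    using C(1) E \<open>d > 0\<close> by simp
  then obtain q where q: "Lp_power \<mu> p (\<lambda>x. t n x - poly q x) < ennreal (d / (2 * E) / C powr p)"
    using polynomials_Lp_approx_bounded[OF fin sets ac p t_meas, of n "real n"] t_bound by blast
  have "Lp_power \<mu> p (\<lambda>x. poly w x * (t n x - poly q x))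
      \<le> ennreal (C powr p) * Lp_power \<mu> p (\<lambda>x. t n x - poly q x)"
    using C p space by (intro Lp_power_le_cmult) (auto simp: abs_mult mult_right_mono)
  also have "\<dots> < ennreal (C powr p) * ennreal (d / (2 * E) / C powr p)"
    using q C(1) by (intro ennreal_mult_strict_left_mono) auto
  also have "\<dots> = \<eta>"
    using C(1) E \<open>d > 0\<close> by (simp add: \<eta>_def flip: ennreal_mult)
  finally have "Lp_power \<mu> p (\<lambda>x. f x - poly w x * t n x)
      + Lp_power \<mu> p (\<lambda>x. poly w x * (t n x - poly q x)) < \<eta> + \<eta>"
    using n by (intro add_strict_mono)
  then have "ennreal E * (Lp_power \<mu> p (\<lambda>x. f x - poly w x * t n x)
      + Lp_power \<mu> p (\<lambda>x. poly w x * (t n x - poly q x))) < ennreal E * (\<eta> + \<eta>)"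
    using E by (intro ennreal_mult_strict_left_mono) auto
  also have "\<dots> = min 1 \<delta>"
    using E \<open>d > 0\<close> by (simp add: \<eta>_def d flip: ennreal_plus ennreal_mult)
  also have "\<dots> \<le> \<delta>" by simp
  finally have *: "ennreal E * (Lp_power \<mu> p (\<lambda>x. f x - poly w x * t n x)
      + Lp_power \<mu> p (\<lambda>x. poly w x * (t n x - poly q x))) < \<delta>" .
  have "Lp_power \<mu> p (\<lambda>x. f x - poly (w * q) x)
      = Lp_power \<mu> p (\<lambda>x. (f x - poly w x * t n x) + poly w x * (t n x - poly q x))"
    by (simp add: algebra_simps)
  also have "\<dots> \<le> ennreal E * (Lp_power \<mu> p (\<lambda>x. f x - poly w x * t n x)
      + Lp_power \<mu> p (\<lambda>x. poly w x * (t n x - poly q x)))"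
    unfolding E_def by (intro Lp_power_add_le p) measurable
  also note *
  finally show ?thesis by blast
qed

section \<open>Finiteness and absolute continuity of the Jacobi measure\<close>

text \<open>For \<open>\<alpha> > -1/2\<close> the density is at most a constant times the derivative of \<open>arcsin\<close>.\<close>

lemma finite_jacobi_measure:
  assumes "\<alpha> > -1/2"
  shows "finite_measure (jacobi_measure \<alpha>)"
proof (rule finite_measureI)
  define c where "c = Gamma (2 * \<alpha> + 2) / (2 powr (2 * \<alpha> + 1) * (Gamma (\<alpha> + 1))\<^sup>2)"
  define s where "s x = (if x \<in> {-1..1} then inverse (sqrt (1 - x\<^sup>2)) else 0)" for x :: real
  have "c \<ge> 0" unfolding c_def using assms
    by (intro divide_nonneg_nonneg mult_nonneg_nonneg less_imp_le[OF Gamma_real_pos]) auto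
  have s_meas [measurable]: "s \<in> borel_measurable borel" unfolding s_def by measurable
  have s_nonneg: "s x \<ge> 0" for x
    unfolding s_def by (auto simp: indicator_def abs_square_le_1)
  \<comment> \<open>\<open>arcsin\<close> is continuous on the closed interval but differentiable
    only inside it, hence the interior form of the fundamental theorem.\<close>
  have "((\<lambda>x. inverse (sqrt (1 - x\<^sup>2))) has_integral (arcsin 1 - arcsin (-1))) {-1..1::real}"
    by (intro fundamental_theorem_of_calculus_interior continuous_on_arcsin')
       (auto intro!: DERIV_arcsin simp flip: has_real_derivative_iff_has_vector_derivative)
  then have "(s has_integral (arcsin 1 - arcsin (-1))) UNIV"
    unfolding s_def by (subst has_integral_restrict_UNIV)
  then have int_s: "(\<integral>\<^sup>+x. ennreal (s x) \<partial>lborel) = ennreal (arcsin 1 - arcsin (-1))"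
    by (intro nn_integral_has_integral_lborel s_meas s_nonneg)
  have le: "c * (1 - x\<^sup>2) powr \<alpha> \<le> c * s x" if "x \<in> {-1..1}" for x
  proof (cases "x\<^sup>2 = 1")
    case False
    have "x\<^sup>2 \<le> 1" using that by (auto simp: abs_square_le_1)
    with False have "0 < 1 - x\<^sup>2" "1 - x\<^sup>2 \<le> 1" by auto
    \<comment> \<open>The base lies in \<open>(0, 1]\<close>, so lowering the exponent from
      \<open>\<alpha>\<close> to \<open>-1/2\<close> increases the power.\<close>
    then have "(1 - x\<^sup>2) powr \<alpha> \<le> (1 - x\<^sup>2) powr (-1/2)"
      using assms by (intro powr_mono') auto
    also have "\<dots> = s x"
      using \<open>0 < 1 - x\<^sup>2\<close> that by (simp add: s_def powr_minus powr_half_sqrt)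
    finally show ?thesis using \<open>c \<ge> 0\<close> by (simp add: mult_left_mono)
  \<comment> \<open>At the endpoints \<open>0 powr \<alpha> = 0\<close>, so the left side vanishes
    even for negative \<open>\<alpha>\<close>.\<close>
  qed (simp add: s_nonneg \<open>c \<ge> 0\<close>)
  have dens: "(\<lambda>x::real. ennreal (c * (1 - x\<^sup>2) powr \<alpha>)) \<in> borel_measurable (lebesgue_on {-1..1})"
    by (intro measurable_restrict_space1 measurable_completion) simp
  have "emeasure (jacobi_measure \<alpha>) (space (jacobi_measure \<alpha>))
      = (\<integral>\<^sup>+x. ennreal (c * (1 - x\<^sup>2) powr \<alpha>) \<partial>lebesgue_on {-1..1})"
    unfolding space_jacobi_measure unfolding jacobi_measure_def c_def[symmetric]
    by (subst emeasure_density[OF dens])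
       (auto intro!: nn_integral_cong sets_restrict_space_iff[THEN iffD2])
  also have "\<dots> \<le> (\<integral>\<^sup>+x. ennreal (c * s x) \<partial>lebesgue_on {-1..1})"
    by (intro nn_integral_mono ennreal_leI le) simp
  also have "\<dots> = (\<integral>\<^sup>+x. ennreal (c * s x) * indicator {-1..1} x \<partial>lebesgue)"
    by (intro nn_integral_restrict_space) simp
  also have "\<dots> \<le> (\<integral>\<^sup>+x. ennreal (c * s x) \<partial>lebesgue)"
    by (intro nn_integral_mono) (auto simp: indicator_def)
  also have "\<dots> = (\<integral>\<^sup>+x. ennreal c * ennreal (s x) \<partial>lborel)"
    using \<open>c \<ge> 0\<close> s_nonneg by (simp add: nn_integral_completion ennreal_mult)
  also have "\<dots> = ennreal c * ennreal (arcsin 1 - arcsin (-1))"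
    by (subst nn_integral_cmult) (auto simp: int_s)
  also have "\<dots> < \<infinity>" by (simp add: ennreal_mult_less_top)
  finally show "emeasure (jacobi_measure \<alpha>) (space (jacobi_measure \<alpha>)) \<noteq> \<infinity>" by simp
qed

text \<open>A measure given by a density inherits the null sets of its base measure; this supplies
  the premise \<open>ac\<close> above.\<close>

lemma AE_lebesgue_on_jacobi_measure:
  assumes "AE x in lebesgue_on {-1..1}. P x"
  shows "AE x in jacobi_measure \<alpha>. P x"
proof -
  have "(\<lambda>x::real. ennreal (Gamma (2 * \<alpha> + 2) / (2 powr (2 * \<alpha> + 1) * (Gamma (\<alpha> + 1))\<^sup>2)
      * (1 - x\<^sup>2) powr \<alpha>)) \<in> borel_measurable (lebesgue_on {-1..1})"
    by (intro measurable_restrict_space1 measurable_completion) simp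
  then show ?thesis
    unfolding jacobi_measure_def by (subst AE_density) (use assms in \<open>auto elim: AE_mp\<close>)
qed

text \<open>The weight \<open>(1 - x^2)^2\<close> vanishes only at -1 and 1, a negligible
  set.\<close>

lemma poly_weight_AE_nonzero: "AE x in jacobi_measure \<alpha>. poly ([:1, 0, -1:] ^ 2) x \<noteq> 0"
proof (rule AE_lebesgue_on_jacobi_measure)
  have "AE x in lebesgue. x \<notin> {-1, 1::real}"
    by (intro AE_not_in) (simp flip: negligible_iff_null_sets)
  then have "AE x in lebesgue. x \<in> {-1..1} \<longrightarrow> poly ([:1, 0, -1:] ^ 2) x \<noteq> (0::real)"
    by (rule eventually_mono) (auto simp: square_eq_1_iff)
  then show "AE x in lebesgue_on {-1..1}. poly ([:1, 0, -1:] ^ 2) x \<noteq> (0::real)"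
    by (subst AE_restrict_space_iff) auto
qed

section \<open>Values and one-sided derivatives at the endpoints\<close>

lemma hermite_interpolation:
  fixes a b c d :: real
  obtains q where "poly q 1 = a" "poly q (-1) = b"
    "poly (pderiv q) 1 = c" "poly (pderiv q) (-1) = d"
proof
  define s where "s = (a - b) / 2"
  \<comment> \<open>The affine part has slope \<open>s\<close> and matches the values. Since
    \<open>x^2 - 1\<close> vanishes at both endpoints with derivatives 2 and -2, its linear cofactor
    \<open>r\<close> is determined by \<open>s + 2 * r(1) = c\<close> and
    \<open>s - 2 * r(-1) = d\<close>.\<close>
  define q where "q = [:(a + b) / 2, s:] + [:-1, 0, 1:] * [:(c - d) / 4, (c + d - 2 * s) / 4:]"
  show "poly q 1 = a" "poly q (-1) = b" "poly (pderiv q) 1 = c" "poly (pderiv q) (-1) = d"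
    by (simp_all add: q_def s_def pderiv_pCons field_simps)
qed

text \<open>Derivatives within a nondegenerate interval are unique also at its endpoints, so
  \<open>end_deriv\<close> takes the value found by the difference rule.\<close>

lemma end_deriv_diff_poly:
  assumes "f differentiable (at a within {-1..1})" "a \<in> {-1..1}"
  shows "(\<lambda>x. f x - poly q x) differentiable (at a within {-1..1})"
    and "end_deriv (\<lambda>x. f x - poly q x) a = end_deriv f a - poly (pderiv q) a"
proof -
  have "(f has_vector_derivative end_deriv f a) (at a within {-1..1})"
    using assms(1) vector_derivative_works by blast
  moreover have "(poly q has_vector_derivative poly (pderiv q) a) (at a within {-1..1})"
    using poly_DERIV[of q a, THEN has_field_derivative_at_within]
    by (simp add: has_real_derivative_iff_has_vector_derivative)
  ultimately have D: "((\<lambda>x. f x - poly q x) has_vector_derivative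
      end_deriv f a - poly (pderiv q) a) (at a within {-1..1})"
    by (rule has_vector_derivative_diff)
  then show "(\<lambda>x. f x - poly q x) differentiable (at a within {-1..1})"
    by (rule differentiableI_vector)
  show "end_deriv (\<lambda>x. f x - poly q x) a = end_deriv f a - poly (pderiv q) a"
    using vector_derivative_within_cbox[of "-1" 1 a] D assms(2) by (simp add: cbox_interval)
qed

section \<open>Density in the norm of \<open>W_space\<close>\<close>

lemma W_power_approx:
  assumes "\<alpha> > -1/2" "1 < p" "f \<in> borel_measurable (jacobi_measure \<alpha>)" "has_end_derivs f"
    and "W_power \<alpha> p M N f < \<infinity>" "\<delta> > 0"
  shows "\<exists>q. W_power \<alpha> p M N (\<lambda>x. f x - poly q x) < \<delta>"
proof -
  define \<mu> where "\<mu> = jacobi_measure \<alpha>"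
  have sets: "sets \<mu> = sets (lebesgue_on {-1..1})" by (simp add: \<mu>_def)
  have fin: "finite_measure \<mu>" unfolding \<mu>_def by (rule finite_jacobi_measure[OF assms(1)])
  have fm: "f \<in> borel_measurable \<mu>" using assms(3) by (simp add: \<mu>_def)
  have p: "p > 0" using assms(2) by simp
  obtain H where H: "poly H 1 = f 1" "poly H (-1) = f (-1)"
    "poly (pderiv H) 1 = end_deriv f 1" "poly (pderiv H) (-1) = end_deriv f (-1)"
    by (rule hermite_interpolation)
  have "bounded (poly H ` {-1..1})"
    by (intro compact_imp_bounded compact_continuous_image continuous_on_poly[OF continuous_on_id]) simp
  then obtain C where C: "C > 0" "\<And>x. x \<in> {-1..1} \<Longrightarrow> \<bar>poly H x\<bar> \<le> C"
    unfolding bounded_pos by auto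
  have "Lp_power \<mu> p (\<lambda>x. - poly H x) < \<infinity>"
    using C by (intro Lp_power_bounded_finite[OF fin p, of _ C]) (auto simp: \<mu>_def)
  moreover have "Lp_power \<mu> p f < \<infinity>"
    using assms(5) by (auto simp: W_power_def \<mu>_def)
  moreover have "Lp_power \<mu> p (\<lambda>x. f x + - poly H x)
      \<le> ennreal (2 powr p) * (Lp_power \<mu> p f + Lp_power \<mu> p (\<lambda>x. - poly H x))"
    using fm p poly_borel_measurable_lebesgue_on[OF sets] by (intro Lp_power_add_le) auto
  ultimately have "Lp_power \<mu> p (\<lambda>x. f x - poly H x) < \<infinity>"
    by (simp add: ennreal_mult_less_top le_less_trans)
  moreover have "(\<lambda>x. f x - poly H x) \<in> borel_measurable \<mu>"
    using fm poly_borel_measurable_lebesgue_on[OF sets] by simp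
  ultimately obtain r where
    r: "Lp_power \<mu> p (\<lambda>x. f x - poly H x - poly ([:1, 0, -1:] ^ 2 * r) x) < \<delta>"
    using weighted_polynomials_Lp_dense[OF fin sets _ p _ _ assms(6)]
      AE_lebesgue_on_jacobi_measure poly_weight_AE_nonzero
    unfolding \<mu>_def by blast
  define q where "q = H + [:1, 0, -1:] ^ 2 * r"
  \<comment> \<open>The added term has double zeros at -1 and 1, so \<open>q\<close> keeps the
    boundary data of \<open>H\<close>, which are those of \<open>f\<close>.\<close>
  have "poly q 1 = f 1" "poly q (-1) = f (-1)"
    "poly (pderiv q) 1 = end_deriv f 1" "poly (pderiv q) (-1) = end_deriv f (-1)"
    by (simp_all add: q_def H pderiv_add pderiv_diff pderiv_smult pderiv_pCons power2_eq_square)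
  then have "W_power \<alpha> p M N (\<lambda>x. f x - poly q x) = Lp_power \<mu> p (\<lambda>x. f x - poly q x)"
    using assms(4) by (simp add: W_power_def \<mu>_def has_end_derivs_def end_deriv_diff_poly)
  also have "\<dots> < \<delta>" using r by (simp add: q_def algebra_simps)
  finally show ?thesis by blast
qed

text \<open>The strict bound forces \<open>t\<close> to be finite, so the root is a real power,
  which is strictly increasing.\<close>

lemma ennreal_root_less:
  assumes "t < ennreal (e powr p)" "p > 0" "e > 0"
  shows "ennreal_root p t < ennreal e"
proof -
  have "t < \<infinity>" using assms(1) by (simp add: less_trans[OF _ ennreal_less_top])
  then obtain r where r: "t = ennreal r" "r \<ge> 0" by (cases t) auto
  with assms have "r < e powr p" by (simp add: ennreal_less_iff)
  then have "r powr (1 / p) < (e powr p) powr (1 / p)"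
    using r assms by (intro powr_less_mono2) auto
  also have "\<dots> = e" using assms by (simp add: powr_powr)
  finally show ?thesis using r by (simp add: ennreal_root_def ennreal_less_iff)
qed

theorem theorem1p2:
  fixes \<alpha> p M N :: real
  assumes "\<alpha> > -1/2" and "1 < p" and "M \<ge> 0" and "N \<ge> 0"
  shows "\<forall>F \<in> W_space \<alpha> p M N. \<forall>\<epsilon>::real. \<epsilon> > 0 \<longrightarrow>
    (\<exists>q :: real poly. W_norm \<alpha> p M N (class_diff F (class_of \<alpha> p M (poly q))) < ennreal \<epsilon>)"
proof (intro ballI allI impI)
  fix F and \<epsilon> :: real assume F: "F \<in> W_space \<alpha> p M N" and \<epsilon>: "\<epsilon> > 0"
  define \<nu> where "\<nu> = jacobi_mass_measure \<alpha> M"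
  from F obtain f where f: "f \<in> F" "has_end_derivs f" "W_power \<alpha> p M N f < \<infinity>"
    and Fq: "F \<in> borel_measurable \<nu> // Lp_rel \<nu> p"
    unfolding W_space_def \<nu>_def by auto
  from Fq obtain f0 where "F = Lp_rel \<nu> p `` {f0}" by (auto elim: quotientE)
  then have f0: "F = Lp_rel \<nu> p `` {f0}" "(f0, f) \<in> Lp_rel \<nu> p" using f(1) by auto
  \<comment> \<open>A class is generated by any of its members, so the arbitrary \<open>f0\<close>
    may be exchanged for \<open>f\<close>, which has the end derivatives.\<close>
  then have F_eq: "F = class_of \<alpha> p M f" and f_meas: "f \<in> borel_measurable \<nu>"
    using equiv_class_eq[OF equiv_Lp_rel, of f0 f \<nu> p]
    by (auto simp: class_of_def \<nu>_def Lp_rel_iff_AE)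
  have "f \<in> borel_measurable (jacobi_measure \<alpha>)"
    using f_meas measurable_cong_sets[of \<nu> "jacobi_measure \<alpha>" borel borel] by (simp add: \<nu>_def)
  \<comment> \<open>\<open>W_power\<close> is the p-th power of the norm, so the tolerance is
    \<open>\<epsilon> powr p\<close>.\<close>
  then obtain q where q: "W_power \<alpha> p M N (\<lambda>x. f x - poly q x) < ennreal (\<epsilon> powr p)"
    using W_power_approx[OF assms(1,2) _ f(2,3), of "ennreal (\<epsilon> powr p)"] \<epsilon> by auto
  have q_meas: "poly q \<in> borel_measurable \<nu>"
    by (rule poly_borel_measurable_lebesgue_on[where S = "{-1..1}"]) (simp add: \<nu>_def)
  define h where "h = (\<lambda>x. f x - poly q x)"
  have h_meas: "h \<in> borel_measurable \<nu>" using f_meas q_meas by (simp add: h_def)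
  have "class_diff F (class_of \<alpha> p M (poly q)) = class_of \<alpha> p M h"
    using class_diff_class_of[of f \<alpha> M "poly q" p] f_meas q_meas
    by (simp add: F_eq h_def \<nu>_def)
  \<comment> \<open>\<open>W_norm\<close> selects its representative by choice;
    \<open>W_norm_eq\<close> permits evaluating it at \<open>h\<close>.\<close>
  moreover have "W_norm \<alpha> p M N (class_of \<alpha> p M h) = ennreal_root p (W_power \<alpha> p M N h)"
  proof (rule W_norm_eq)
    show "class_of \<alpha> p M h
        \<in> borel_measurable (jacobi_mass_measure \<alpha> M) // Lp_rel (jacobi_mass_measure \<alpha> M) p"
      using h_meas unfolding class_of_def \<nu>_def by (rule quotientI)
    show "h \<in> class_of \<alpha> p M h"
      using h_meas by (simp add: class_of_def \<nu>_def Lp_rel_iff_AE)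
    show "has_end_derivs h"
      using f(2) by (auto simp: has_end_derivs_def h_def intro!: end_deriv_diff_poly)
  qed (use assms in simp)
  moreover have "ennreal_root p (W_power \<alpha> p M N h) < ennreal \<epsilon>"
    unfolding h_def by (rule ennreal_root_less[OF q]) (use assms(2) \<epsilon> in auto)
  ultimately show "\<exists>q. W_norm \<alpha> p M N (class_diff F (class_of \<alpha> p M (poly q))) < ennreal \<epsilon>"
    by (intro exI[of _ q]) simp
qed

end
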